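(* Let $f(x)=\sum_{k=0}^{\infty}c_kx^k$ be a real power series with $c_k\ge 0$ for all $k\ge 0$, with radius of convergence $R\in(0,\infty]$, regarded as a function on its domain of convergence $I=(-R,R)\subseteq\mathbb{R}$. Then for every integer $N\ge 1$ and every positive semidefinite matrix $A\in I^{N\times N}$, the matrix $f_{\diamond}(A)$ is positive semidefinite.
   Context: Matrices in $\mathbb{C}^{N\times N}$ are indexed by $(i,j)\in\mathcal{K}_{N,N}:=\{0,\dots,N-1\}\times\{0,\dots,N-1\}$; put $\mathcal{K}^*_{N,N}:=\mathcal{K}_{N,N}\setminus\{(0,0)\}$. A matrix $A$ with $A^*=A$ is positive semidefinite if $z^*Az\ge 0$ for all $z\in\mathbb{C}^N$. For an integer $\ell\ge1$ and $(i,j)\in\mathcal{K}^*_{N,N}$, let $\mathcal{P}^*_\ell(i,j)$ be the set of all multisets $S$ of $\ell$ elements (counted with multiplicity) of $\mathcal{K}^*_{N,N}$ with $\sum_{(p,q)\in S}(p,q)=(i,j)$; $c_S(m,n)$ denotes the multiplicity of $(m,n)$ in $S$. For a function $f:I\to\mathbb{R}$ that is $2N-2$ times differentiable and $A=(a_{ij})\in I^{N\times N}$, the matrix $f_\diamond(A)\in\mathbb{R}^{N\times N}$ is defined by $(f_\diamond(A))_{00}:=f(a_{00})$ and, for $(i,j)\in\mathcal{K}^*_{N,N}$, $$(f_\diamond(A))_{ij}:=\sum_{\ell=1}^{i+j}f^{(\ell)}(a_{00})\sum_{S\in\mathcal{P}^*_\ell(i,j)}\frac{1}{\prod_{(m,n)\in\mathcal{K}^*_{N,N}}c_S(m,n)!}\prod_{(p,q)\in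 S}a_{p,q},$$ the product over the multiset $S$ being taken with multiplicity. *)

theory Defs
  imports "HOL-Analysis.Analysis" "Jordan_Normal_Form.Schur_Decomposition"
begin

(* In the order on the complex numbers used here, 0 \<le> w says that w is real and
   nonnegative; (B *\<^sub>v z) \<bullet>c z is z^* B z. *)
definition psd_mat :: "complex mat \<Rightarrow> bool" where
  "psd_mat B \<longleftrightarrow> square_mat B \<and> mat_adjoint B = B \<and>
     (\<forall>z \<in> carrier_vec (dim_row B). 0 \<le> (B *\<^sub>v z) \<bullet>c z)"

definition Kstar :: "nat \<Rightarrow> (nat \<times> nat) set" where
  "Kstar N = ({0..<N} \<times> {0..<N}) - {(0, 0)}"

definition Pstar :: "nat \<Rightarrow> nat \<Rightarrow> nat \<times> nat \<Rightarrow> (nat \<times> nat) multiset set" where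
  "Pstar N l ij = {S. set_mset S \<subseteq> Kstar N \<and> size S = l \<and> (\<Sum>pq \<in># S. pq) = ij}"

(* The derivatives are iterated derivatives of f as a function on the reals;
   they only depend on f near A $$ (0, 0). *)
definition diamond :: "(real \<Rightarrow> real) \<Rightarrow> real mat \<Rightarrow> real mat" where
  "diamond f A = (let N = dim_row A in mat N N (\<lambda>(i, j).
     if (i, j) = (0, 0) then f (A $$ (0, 0))
     else \<Sum>l = 1..i + j. (deriv ^^ l) f (A $$ (0, 0)) *
            (\<Sum>S \<in> Pstar N l (i, j).
               1 / (\<Prod>mn \<in> Kstar N. fact (count S mn)) * (\<Prod>pq \<in># S. A $$ pq))))"

end

theory Submission
  imports Defs
begin

text \<open>Let a(x,y) be the bivariate polynomial with coefficient matrix A. Up to truncation,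
  f_diamond(A) is the coefficient matrix of f(a(x,y)): it is the sum over k of c_k times the
  coefficient matrix of a(x,y)^k, where the binomial expansion of (a_00 + (a(x,y) - a_00))^k
  produces the derivatives of f at a_00 and the sum over multisets collects equal products in
  (a(x,y) - a_00)^l. Multiplying polynomials convolves their coefficient matrices, and convolution
  preserves positive semidefiniteness: if A is a sum of matrices u u^T, the quadratic form of the
  convolution of A and B at z is the sum over u of that of B at the correlations of z with u.
  As c_k is nonnegative, so is the sum of the series.\<close>

section \<open>Real positive semidefinite kernels and their factorisation\<close>

text \<open>An arbitrary index set permits induction by removing one index. Symmetry is demanded
  separately because the real quadratic form does not see the antisymmetric part.\<close>

definition psd_on :: "'a set \<Rightarrow> ('a \<Rightarrow> 'a \<Rightarrow> real) \<Rightarrow> bool" where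
  "psd_on S a \<longleftrightarrow> (\<forall>i\<in>S. \<forall>j\<in>S. a i j = a j i) \<and>
     (\<forall>z. 0 \<le> (\<Sum>i\<in>S. \<Sum>j\<in>S. z i * z j * a i j))"

lemma psd_on_sym: "psd_on S a \<Longrightarrow> i \<in> S \<Longrightarrow> j \<in> S \<Longrightarrow> a i j = a j i"
  by (simp add: psd_on_def)

lemma psd_on_nonneg: "psd_on S a \<Longrightarrow> 0 \<le> (\<Sum>i\<in>S. \<Sum>j\<in>S. z i * z j * a i j)"
  by (simp add: psd_on_def)

lemma quadratic_form_insert:
  fixes a :: "'a \<Rightarrow> 'a \<Rightarrow> real"
  assumes "finite F" "x \<notin> F" "\<And>i. i \<in> F \<Longrightarrow> a i x = a x i"
  shows "(\<Sum>i\<in>insert x F. \<Sum>j\<in>insert x F. z i * z j * a i j) =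
    (z x)\<^sup>2 * a x x + 2 * z x * (\<Sum>j\<in>F. z j * a x j) + (\<Sum>i\<in>F. \<Sum>j\<in>F. z i * z j * a i j)"
proof -
  have "(\<Sum>i\<in>F. z i * z x * a i x) = z x * (\<Sum>j\<in>F. z j * a x j)"
    using assms(3) by (simp add: sum_distrib_left mult_ac)
  moreover have "(\<Sum>j\<in>F. z x * z j * a x j) = z x * (\<Sum>j\<in>F. z j * a x j)"
    by (simp add: sum_distrib_left mult_ac)
  ultimately show ?thesis
    using assms(1,2) by (simp add: sum.distrib power2_eq_square algebra_simps)
qed

text \<open>If \<open>a x x\<close> vanishes, the quadratic form at \<open>t\<close> times the unit
  vector of \<open>x\<close> plus that of \<open>j\<close> is affine in \<open>t\<close> with slope
  \<open>2 * a x j\<close>, so a nonzero slope would make it negative somewhere.\<close>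

lemma psd_on_insert_zero_diag:
  assumes psd: "psd_on (insert x F) a" and "finite F" "x \<notin> F" "j \<in> F" "a x x = 0"
  shows "a x j = 0"
proof (rule ccontr)
  assume nz: "a x j \<noteq> 0"
  \<comment> \<open>This solves \<open>2 * t * a x j + a j j = -1\<close>.\<close>
  define t where "t = - (a j j + 1) / (2 * a x j)"
  define z where "z i = (if i = x then t else if i = j then 1 else 0)" for i
  have zF: "z i = (if i = j then 1 else 0)" if "i \<in> F" for i
    using that assms(3) by (auto simp: z_def)
  have "(\<Sum>i\<in>insert x F. \<Sum>j\<in>insert x F. z i * z j * a i j) =
    (z x)\<^sup>2 * a x x + 2 * z x * (\<Sum>j\<in>F. z j * a x j) + (\<Sum>i\<in>F. \<Sum>j\<in>F. z i * z j * a i j)"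
    using assms psd_on_sym[OF psd] by (intro quadratic_form_insert) auto
  also have "(\<Sum>j\<in>F. z j * a x j) = a x j"
    using assms(2,4) by (simp add: zF if_distrib[of "\<lambda>x. x * _"] cong: sum.cong if_cong)
  also have "(\<Sum>i\<in>F. \<Sum>k\<in>F. z i * z k * a i k) = (\<Sum>i\<in>F. if i = j then a j j else 0)"
    using assms(2,4)
    by (intro sum.cong refl) (simp add: zF if_distrib[of "\<lambda>x. x * _"] cong: sum.cong if_cong)
  also have "\<dots> = a j j"
    using assms(2,4) by simp
  also have "(z x)\<^sup>2 * a x x + 2 * z x * a x j + a j j = -1"
    using assms(5) nz by (simp add: z_def t_def field_simps)
  finally show False using psd_on_nonneg[OF psd, of z] by linarith
qed

text \<open>Cholesky factorisation. When a x x = 0, the junk value 0 of the quotients by a x x is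
  the right one, since then the whole row of x vanishes.\<close>
lemma psd_on_decomposition:
  assumes "finite S" "psd_on S a"
  shows "\<exists>u. \<forall>i\<in>S. \<forall>j\<in>S. a i j = (\<Sum>r\<in>S. u r i * u r j)"
  using assms
proof (induction S arbitrary: a rule: finite_induct)
  case empty
  then show ?case by simp
next
  case (insert x F)
  note psd = insert.prems
  have sym: "a i j = a j i" if "i \<in> insert x F" "j \<in> insert x F" for i j
    using psd_on_sym[OF psd] that .
  have Q: "(\<Sum>i\<in>insert x F. \<Sum>j\<in>insert x F. z i * z j * a i j) = (z x)\<^sup>2 * a x x
      + 2 * z x * (\<Sum>j\<in>F. z j * a x j) + (\<Sum>i\<in>F. \<Sum>j\<in>F. z i * z j * a i j)" for z
    using insert.hyps sym by (intro quadratic_form_insert) auto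
  have Q: "0 \<le> (z x)\<^sup>2 * a x x + 2 * z x * (\<Sum>j\<in>F. z j * a x j)
      + (\<Sum>i\<in>F. \<Sum>j\<in>F. z i * z j * a i j)" for z
    using psd_on_nonneg[OF psd, of z] unfolding Q .
  have diag: "0 \<le> a x x"
  proof -
    have [simp]: "i = x \<longleftrightarrow> False" if "i \<in> F" for i using that insert.hyps(2) by auto
    show ?thesis using Q[of "\<lambda>i. if i = x then 1 else 0"] by (simp cong: sum.cong)
  qed
  \<comment> \<open>The Schur complement of \<open>a x x\<close>: what is left of \<open>a\<close>
    after splitting off the rank-one kernel of the row of \<open>x\<close>.\<close>
  define b where "b i j = a i j - a x i * a x j / a x x" for i j
  have "psd_on F b"
    unfolding psd_on_def
  proof (intro conjI ballI allI)
    fix i j assume "i \<in> F" "j \<in> F"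
    then show "b i j = b j i" using sym[of i j] by (simp add: b_def)
  next
    fix z :: "'a \<Rightarrow> real"
    define s where "s = (\<Sum>j\<in>F. z j * a x j)"
    have [simp]: "(if i = x then w else z i) = z i" if "i \<in> F" for i w
      using that insert.hyps(2) by auto
    have "s * s = (\<Sum>i\<in>F. \<Sum>j\<in>F. z i * z j * (a x i * a x j))"
      unfolding s_def sum_product by (simp add: mult_ac)
    then have "s * s / a x x = (\<Sum>i\<in>F. \<Sum>j\<in>F. z i * z j * (a x i * a x j / a x x))"
      by (simp add: sum_divide_distrib)
    then have "(\<Sum>i\<in>F. \<Sum>j\<in>F. z i * z j * b i j) =
        (\<Sum>i\<in>F. \<Sum>j\<in>F. z i * z j * a i j) - s * s / a x x"
      by (simp add: b_def right_diff_distrib sum_subtractf)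
    \<comment> \<open>For \<open>a x x > 0\<close> this value of \<open>z x\<close> completes the
      square, so the minimum over \<open>z x\<close> of the form of \<open>a\<close> is the form of
      \<open>b\<close>.\<close>
    moreover have "0 \<le> (- s / a x x)\<^sup>2 * a x x + 2 * (- s / a x x) * s
        + (\<Sum>i\<in>F. \<Sum>j\<in>F. z i * z j * a i j)"
      using Q[of "\<lambda>i. if i = x then - s / a x x else z i"]
      by (simp add: s_def[symmetric] cong: sum.cong)
    moreover have "(- s / a x x)\<^sup>2 * a x x + 2 * (- s / a x x) * s = - (s * s / a x x)"
      by (cases "a x x = 0") (simp_all add: power2_eq_square)
    ultimately show "0 \<le> (\<Sum>i\<in>F. \<Sum>j\<in>F. z i * z j * b i j)"
      by simp
  qed
  then obtain v where v: "\<And>i j. i \<in> F \<Longrightarrow> j \<in> F \<Longrightarrow> b i j = (\<Sum>r\<in>F. v r i * v r j)"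
    using insert.IH by blast
  \<comment> \<open>The new factor is the scaled row of \<open>x\<close>; the factors of
    \<open>b\<close> are extended by zero at \<open>x\<close>.\<close>
  define u where "u r i = (if r = x then a x i / sqrt (a x x) else if i = x then 0 else v r i)"
    for r i
  have ux: "u x i * u x j = a x i * a x j / a x x" for i j
    using diag by (simp add: u_def)
  have row: "a x j * a x x / a x x = a x j" if "j \<in> insert x F" for j
    using psd_on_insert_zero_diag[OF psd insert.hyps, of j] that by (cases "a x x = 0") auto
  have u_x: "u r x = 0" if "r \<in> F" for r using that insert.hyps by (auto simp: u_def)
  have u_F: "u r i = v r i" if "r \<in> F" "i \<in> F" for r i
    using that insert.hyps by (auto simp: u_def)
  have "a i j = (\<Sum>r\<in>insert x F. u r i * u r j)"
    if "i \<in> insert x F" "j \<in> insert x F" for i j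
  proof (cases "i \<in> F \<and> j \<in> F")
    case True
    then have "(\<Sum>r\<in>F. u r i * u r j) = b i j" using v[of i j] by (simp add: u_F)
    then show ?thesis using insert.hyps ux[of i j] by (simp add: b_def)
  next
    case False
    then have "i = x \<or> j = x" using that by auto
    then show ?thesis
      using that insert.hyps ux[of i j] row[of i] row[of j] sym[of i j]
      by (auto simp: u_x mult.commute)
  qed
  then show ?case by blast
qed

section \<open>Convolution of kernels\<close>

definition conv_kernel :: "(nat \<Rightarrow> nat \<Rightarrow> real) \<Rightarrow> (nat \<Rightarrow> nat \<Rightarrow> real) \<Rightarrow> nat \<Rightarrow> nat \<Rightarrow> real" where
  "conv_kernel a b i j = (\<Sum>p\<le>i. \<Sum>q\<le>j. a p q * b (i - p) (j - q))"

text \<open>The adjoint of convolution with \<open>u\<close> is correlation with \<open>u\<close>: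
  both sides add up \<open>z i * u (i - s) * h s\<close> over \<open>s \<le> i < N\<close>.\<close>

lemma sum_convolution_transpose:
  fixes z u h :: "nat \<Rightarrow> real"
  shows "(\<Sum>i<N. z i * (\<Sum>p\<le>i. u p * h (i - p))) = (\<Sum>s<N. (\<Sum>i=s..<N. z i * u (i - s)) * h s)"
proof -
  have "(\<Sum>p\<le>i. u p * h (i - p)) = (\<Sum>s\<le>i. u (i - s) * h s)" for i
    by (rule sum.reindex_bij_witness[of _ "\<lambda>s. i - s" "\<lambda>s. i - s"]) auto
  then have "(\<Sum>i<N. z i * (\<Sum>p\<le>i. u p * h (i - p))) = (\<Sum>i<N. \<Sum>s\<le>i. z i * u (i - s) * h s)"
    by (simp add: sum_distrib_left mult.assoc)
  also have "\<dots> = (\<Sum>s<N. \<Sum>i=s..<N. z i * u (i - s) * h s)"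
    by (simp add: sum.Sigma,
      rule sum.reindex_bij_witness[of _ prod.swap prod.swap]) auto
  finally show ?thesis by (simp add: sum_distrib_right)
qed

text \<open>Convolving \<open>b\<close> with a rank-one kernel convolves each of its two indices
  with the same vector. Moving both convolutions to the test vector gives the form of
  \<open>b\<close> at a correlated vector.\<close>

lemma psd_on_conv_kernel:
  assumes "psd_on {..<N} a" "psd_on {..<N} b"
  shows "psd_on {..<N} (conv_kernel a b)"
  unfolding psd_on_def
proof (intro conjI ballI allI)
  fix i j assume "i \<in> {..<N}" "j \<in> {..<N}"
  then have "conv_kernel a b i j = (\<Sum>p\<le>i. \<Sum>q\<le>j. a q p * b (j - q) (i - p))"
    unfolding conv_kernel_def
    using assms[THEN psd_on_sym] by (intro sum.cong refl arg_cong2[of _ _ _ _ "(*)"]) auto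
  also have "\<dots> = conv_kernel a b j i"
    unfolding conv_kernel_def by (rule sum.swap)
  finally show "conv_kernel a b i j = conv_kernel a b j i" .
next
  fix z :: "nat \<Rightarrow> real"
  obtain u where u: "\<And>p q. p < N \<Longrightarrow> q < N \<Longrightarrow> a p q = (\<Sum>r<N. u r p * u r q)"
    using psd_on_decomposition[OF finite_lessThan assms(1)] by blast
  \<comment> \<open>\<open>w r\<close> is the correlation of \<open>z\<close> with the factor
    \<open>u r\<close>, and \<open>g r\<close> is the contribution of that factor to the
    convolution.\<close>
  define w where "w r s = (\<Sum>i=s..<N. z i * u r (i - s))" for r s
  define g where "g r i j = (\<Sum>p\<le>i. u r p * (\<Sum>q\<le>j. u r q * b (i - p) (j - q)))" for r i j
  have conv: "conv_kernel a b i j = (\<Sum>r<N. g r i j)" if "i < N" "j < N" for i j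
  proof -
    have "conv_kernel a b i j =
        (\<Sum>p\<le>i. \<Sum>q\<le>j. \<Sum>r<N. u r p * (u r q * b (i - p) (j - q)))"
      unfolding conv_kernel_def using that
      by (intro sum.cong refl) (simp add: u sum_distrib_right mult.assoc)
    also have "\<dots> = (\<Sum>p\<le>i. \<Sum>r<N. \<Sum>q\<le>j. u r p * (u r q * b (i - p) (j - q)))"
      by (intro sum.cong refl sum.swap)
    also have "\<dots> = (\<Sum>r<N. \<Sum>p\<le>i. \<Sum>q\<le>j. u r p * (u r q * b (i - p) (j - q)))"
      by (rule sum.swap)
    finally show ?thesis by (simp add: g_def sum_distrib_left)
  qed
  have gw: "(\<Sum>i<N. \<Sum>j<N. z i * z j * g r i j) = (\<Sum>s<N. \<Sum>t<N. w r s * w r t * b s t)" for r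
  proof -
    have "(\<Sum>i<N. \<Sum>j<N. z i * z j * g r i j) = (\<Sum>j<N. z j * (\<Sum>i<N. z i * g r i j))"
      by (subst sum.swap) (simp add: sum_distrib_left mult_ac)
    also have "\<dots> = (\<Sum>j<N. z j * (\<Sum>s<N. w r s * (\<Sum>q\<le>j. u r q * b s (j - q))))"
      unfolding g_def w_def
      \<comment> \<open>The transposition is applied in the first index while \<open>j\<close> is
        held fixed; the second index follows below.\<close>
      by (subst sum_convolution_transpose[where h = "\<lambda>s. \<Sum>q\<le>_. u r q * b s (_ - q)"]) simp
    also have "\<dots> = (\<Sum>s<N. w r s * (\<Sum>j<N. z j * (\<Sum>q\<le>j. u r q * b s (j - q))))"
      unfolding sum_distrib_left by (subst sum.swap) (simp add: mult_ac)
    also have "\<dots> = (\<Sum>s<N. w r s * (\<Sum>t<N. w r t * b s t))"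
      unfolding sum_convolution_transpose w_def ..
    finally show ?thesis by (simp add: sum_distrib_left mult.assoc)
  qed
  have "(\<Sum>i<N. \<Sum>j<N. z i * z j * conv_kernel a b i j) =
      (\<Sum>i<N. \<Sum>j<N. \<Sum>r<N. z i * z j * g r i j)"
    by (simp add: conv sum_distrib_left)
  also have "\<dots> = (\<Sum>i<N. \<Sum>r<N. \<Sum>j<N. z i * z j * g r i j)"
    by (intro sum.cong refl sum.swap)
  also have "\<dots> = (\<Sum>r<N. \<Sum>i<N. \<Sum>j<N. z i * z j * g r i j)"
    by (rule sum.swap)
  also have "\<dots> \<ge> 0"
    unfolding gw by (rule sum_nonneg, rule psd_on_nonneg[OF assms(2)])
  finally show "0 \<le> (\<Sum>i<N. \<Sum>j<N. z i * z j * conv_kernel a b i j)" .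
qed

text \<open>For a fixed test vector the quadratic form is linear in the entries, so it can be taken
  termwise, and each term is nonnegative.\<close>

lemma psd_on_sums:
  assumes "\<And>k. psd_on S (a k)" "\<And>k. 0 \<le> c k"
    and sums: "\<And>i j. i \<in> S \<Longrightarrow> j \<in> S \<Longrightarrow> (\<lambda>k. c k * a k i j) sums d i j"
  shows "psd_on S d"
  unfolding psd_on_def
proof (intro conjI ballI allI)
  fix i j assume ij: "i \<in> S" "j \<in> S"
  have "(\<lambda>k. c k * a k i j) = (\<lambda>k. c k * a k j i)"
    by (simp add: psd_on_sym[OF assms(1) ij])
  then show "d i j = d j i"
    using sums[OF ij] sums[OF ij(2,1)] by (simp add: sums_unique2)
next
  fix z :: "'a \<Rightarrow> real"
  have form_sums: "(\<lambda>k. \<Sum>i\<in>S. \<Sum>j\<in>S. z i * z j * (c k * a k i j)) sums (\<Sum>i\<in>S. \<Sum>j\<in>S. z i * z j * d i j)"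
    by (intro sums_sum sums_mult sums)
  have "0 \<le> (\<Sum>i\<in>S. \<Sum>j\<in>S. z i * z j * (c k * a k i j))" for k
  proof -
    have "(\<Sum>i\<in>S. \<Sum>j\<in>S. z i * z j * (c k * a k i j)) =
        c k * (\<Sum>i\<in>S. \<Sum>j\<in>S. z i * z j * a k i j)"
      by (simp add: sum_distrib_left mult_ac)
    then show ?thesis using assms(2) psd_on_nonneg[OF assms(1)] by simp
  qed
  then show "0 \<le> (\<Sum>i\<in>S. \<Sum>j\<in>S. z i * z j * d i j)"
    by (rule sums_le[OF _ sums_zero form_sums])
qed

section \<open>Real matrices as complex matrices\<close>

lemma mat_adjoint_index:
  "i < dim_col B \<Longrightarrow> j < dim_row B \<Longrightarrow> mat_adjoint B $$ (i, j) = conjugate (B $$ (j, i))"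
  by (simp add: mat_adjoint_def mat_of_rows_def)

text \<open>For a real symmetric matrix the form at a complex vector is the sum of the forms at its
  real and imaginary parts, since the cross terms cancel. Conversely, real vectors are special
  complex ones.\<close>

lemma psd_mat_of_real_iff:
  fixes A :: "real mat"
  assumes A: "A \<in> carrier_mat N N"
  shows "psd_mat (map_mat complex_of_real A) \<longleftrightarrow> psd_on {..<N} (\<lambda>i j. A $$ (i, j))"
proof -
  let ?B = "map_mat complex_of_real A"
  have [simp]: "dim_row A = N" "dim_col A = N" using A by auto
  define Q where "Q z = (\<Sum>i<N. \<Sum>j<N. z i * z j * A $$ (i, j))" for z :: "nat \<Rightarrow> real"
  have adj: "mat_adjoint ?B = ?B \<longleftrightarrow> (\<forall>i<N. \<forall>j<N. A $$ (i, j) = A $$ (j, i))"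
  proof -
    have "mat_adjoint ?B \<in> carrier_mat N N" using A by (auto simp: mat_adjoint_def)
    then have "mat_adjoint ?B = ?B \<longleftrightarrow> (\<forall>i<N. \<forall>j<N. mat_adjoint ?B $$ (i, j) = ?B $$ (i, j))"
      using A by (auto simp: mat_eq_iff)
    then show ?thesis using A by (auto simp: mat_adjoint_index)
  qed
  have form: "(?B *\<^sub>v z) \<bullet>c z = (\<Sum>i<N. \<Sum>j<N. of_real (A $$ (i, j)) * z $ j * cnj (z $ i))"
    if "z \<in> carrier_vec N" for z
  proof -
    have "(?B *\<^sub>v z) $ i = (\<Sum>j<N. of_real (A $$ (i, j)) * z $ j)" if "i < N" for i
      using that \<open>z \<in> carrier_vec N\<close> by (simp add: scalar_prod_def lessThan_atLeast0)
    then show ?thesis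
      using that by (simp add: scalar_prod_def sum_distrib_right lessThan_atLeast0)
  qed
  have nonneg_iff: "(\<forall>z \<in> carrier_vec N. 0 \<le> (?B *\<^sub>v z) \<bullet>c z) \<longleftrightarrow> (\<forall>z. 0 \<le> Q z)"
    if sym: "\<forall>i<N. \<forall>j<N. A $$ (i, j) = A $$ (j, i)"
  proof (intro iffI allI ballI)
    fix z assume *: "\<forall>z \<in> carrier_vec N. 0 \<le> (?B *\<^sub>v z) \<bullet>c z"
    have "0 \<le> (?B *\<^sub>v vec N (\<lambda>i. of_real (z i))) \<bullet>c vec N (\<lambda>i. of_real (z i))"
      using * by simp
    then have "0 \<le> complex_of_real (Q z)"
      by (subst (asm) form) (simp_all add: Q_def mult_ac)
    then show "0 \<le> Q z" by (simp add: less_eq_complex_def)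
  next
    fix z :: "complex vec" assume *: "\<forall>z. 0 \<le> Q z" and z: "z \<in> carrier_vec N"
    have "Re ((?B *\<^sub>v z) \<bullet>c z) = Q (\<lambda>i. Re (z $ i)) + Q (\<lambda>i. Im (z $ i))"
      unfolding form[OF z] Q_def Re_sum sum.distrib[symmetric]
      by (intro sum.cong refl) (simp add: algebra_simps)
    moreover have "Im ((?B *\<^sub>v z) \<bullet>c z) =
        (\<Sum>i<N. \<Sum>j<N. A $$ (i, j) * (Im (z $ j) * Re (z $ i)))
        - (\<Sum>i<N. \<Sum>j<N. A $$ (i, j) * (Re (z $ j) * Im (z $ i)))"
      unfolding form[OF z] Im_sum sum_subtractf[symmetric]
      by (intro sum.cong refl) (simp add: algebra_simps)
    moreover have "(\<Sum>i<N. \<Sum>j<N. A $$ (i, j) * (Im (z $ j) * Re (z $ i))) =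
        (\<Sum>i<N. \<Sum>j<N. A $$ (i, j) * (Re (z $ j) * Im (z $ i)))"
      using sym by (subst sum.swap) (simp add: mult.commute)
    ultimately show "0 \<le> (?B *\<^sub>v z) \<bullet>c z"
      using * by (simp add: less_eq_complex_def)
  qed
  have "psd_mat ?B \<longleftrightarrow> (\<forall>i<N. \<forall>j<N. A $$ (i, j) = A $$ (j, i)) \<and>
      (\<forall>z \<in> carrier_vec N. 0 \<le> (?B *\<^sub>v z) \<bullet>c z)"
    using A adj by (auto simp: psd_mat_def)
  then show ?thesis
    using nonneg_iff by (auto simp: psd_on_def Q_def)
qed

section \<open>Sums over multisets of index pairs\<close>

lemma finite_Kstar [simp]: "finite (Kstar N)"
  by (simp add: Kstar_def)

lemma finite_Pstar [simp]: "finite (Pstar N l ij)"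
proof (rule finite_subset)
  show "Pstar N l ij \<subseteq> {S. set_mset S \<subseteq> Kstar N \<and> size S = l}"
    by (auto simp: Pstar_def)
  show "finite {S. set_mset S \<subseteq> Kstar N \<and> size S = l}"
    using finite_multisets_of_size[OF finite_Kstar] by (simp add: multisets_of_size_def)
qed

definition mset_term :: "nat \<Rightarrow> (nat \<times> nat \<Rightarrow> real) \<Rightarrow> (nat \<times> nat) multiset \<Rightarrow> real" where
  "mset_term N a S = 1 / (\<Prod>x\<in>Kstar N. fact (count S x)) * (\<Prod>x\<in>#S. a x)"

text \<open>For indices below \<open>N\<close>, this is the coefficient at \<open>ij\<close> of the
  \<open>l\<close>-th power of the series \<open>a\<close> without its constant term, divided by
  \<open>fact l\<close>; it is the inner sum in \<open>diamond\<close>.\<close>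

definition partition_sum :: "nat \<Rightarrow> (nat \<times> nat \<Rightarrow> real) \<Rightarrow> nat \<Rightarrow> nat \<times> nat \<Rightarrow> real" where
  "partition_sum N a l ij = (\<Sum>S\<in>Pstar N l ij. mset_term N a S)"

text \<open>The multiplicity of \<open>x\<close> cancels the top factor of its factorial.\<close>

lemma mset_term_add:
  assumes "x \<in> Kstar N"
  shows "real (count (add_mset x S) x) * mset_term N a (add_mset x S) = a x * mset_term N a S"
proof -
  have rest: "(\<Prod>y\<in>Kstar N - {x}. fact (count (add_mset x S) y)) =
      (\<Prod>y\<in>Kstar N - {x}. fact (count S y) :: real)"
    by (intro prod.cong) auto
  have "(\<Prod>y\<in>Kstar N. fact (count (add_mset x S) y) :: real) =
      real (Suc (count S x)) * (\<Prod>y\<in>Kstar N. fact (count S y))"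
    unfolding prod.remove[OF finite_Kstar assms] rest by simp
  then show ?thesis
    by (simp add: mset_term_def field_simps del: of_nat_Suc)
qed

lemma Pstar_add_mset_iff:
  assumes "(p, q) \<in> Kstar N"
  shows "add_mset (p, q) S \<in> Pstar N (Suc l) (i, j) \<longleftrightarrow>
    p \<le> i \<and> q \<le> j \<and> S \<in> Pstar N l (i - p, j - q)"
proof -
  obtain s t where "sum_mset S = (s, t)" by fastforce
  then show ?thesis using assms by (auto simp: Pstar_def)
qed

text \<open>Double counting of multisets with one marked element: the multiplicities add up to
  \<open>Suc l\<close>, and removing the marked element leaves a multiset of size \<open>l\<close>.
  This mirrors splitting one factor off a power.\<close>

lemma partition_sum_Suc:
  "real (Suc l) * partition_sum N a (Suc l) (i, j) =
    (\<Sum>(p, q) \<in> Kstar N \<inter> {..i} \<times> {..j}. a (p, q) * partition_sum N a l (i - p, j - q))"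
proof -
  let ?P = "Pstar N (Suc l) (i, j)"
  have count_sum: "real (Suc l) = (\<Sum>x\<in>Kstar N. real (count S x))" if "S \<in> ?P" for S
  proof -
    have "Suc l = (\<Sum>x\<in>set_mset S. count S x)"
      using that by (simp add: Pstar_def size_multiset_overloaded_eq)
    also have "\<dots> = (\<Sum>x\<in>Kstar N. count S x)"
      using that by (intro sum.mono_neutral_left) (auto simp: Pstar_def not_in_iff)
    finally show ?thesis by simp
  qed
  have inner: "(\<Sum>S\<in>?P. real (count S x) * mset_term N a S) =
      (if x \<in> {..i} \<times> {..j}
       then a x * partition_sum N a l (i - fst x, j - snd x) else 0)"
    if x: "x \<in> Kstar N" for x
  proof -
    obtain p q where pq: "x = (p, q)" by fastforce
    \<comment> \<open>The inequalities are part of the set because truncated subtraction could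
      otherwise admit multisets with the wrong sum.\<close>
    define P' where "P' = {S. p \<le> i \<and> q \<le> j \<and> S \<in> Pstar N l (i - p, j - q)}"
    have iff: "add_mset x S \<in> ?P \<longleftrightarrow> S \<in> P'" for S
      using Pstar_add_mset_iff[of p q N S l i j] x by (simp add: P'_def pq)
    have "(\<Sum>S\<in>?P. real (count S x) * mset_term N a S) =
        (\<Sum>S | S \<in> ?P \<and> x \<in># S. real (count S x) * mset_term N a S)"
      by (intro sum.mono_neutral_right) (auto simp: not_in_iff)
    \<comment> \<open>Removing one copy of \<open>x\<close> is a bijection onto \<open>P'\<close>,
      and the weight changes by \<open>mset_term_add\<close>.\<close>
    also have "\<dots> = (\<Sum>S\<in>P'. a x * mset_term N a S)"
      by (rule sum.reindex_bij_witness[of _ "add_mset x" "\<lambda>S. S - {#x#}"])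
        (auto simp: iff[symmetric] mset_term_add[OF x, symmetric] simp del: count_add_mset)
    also have "\<dots> = (if p \<le> i \<and> q \<le> j then a x * partition_sum N a l (i - p, j - q) else 0)"
      by (auto simp: P'_def partition_sum_def sum_distrib_left)
    finally show ?thesis by (simp add: pq)
  qed
  have "real (Suc l) * partition_sum N a (Suc l) (i, j) =
      (\<Sum>S\<in>?P. \<Sum>x\<in>Kstar N. real (count S x) * mset_term N a S)"
    unfolding partition_sum_def sum_distrib_left
    by (intro sum.cong refl) (simp add: count_sum sum_distrib_right del: of_nat_Suc)
  also have "\<dots> = (\<Sum>x\<in>Kstar N. \<Sum>S\<in>?P. real (count S x) * mset_term N a S)"
    by (rule sum.swap)
  also have "\<dots> = (\<Sum>x\<in>Kstar N. if x \<in> {..i} \<times> {..j}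
      then a x * partition_sum N a l (i - fst x, j - snd x) else 0)"
    by (intro sum.cong refl inner)
  also have "\<dots> = (\<Sum>x \<in> Kstar N \<inter> {..i} \<times> {..j}. a x * partition_sum N a l (i - fst x, j - snd x))"
    by (rule sum.inter_restrict[symmetric]) simp
  finally show ?thesis by (simp add: case_prod_beta)
qed

lemma partition_sum_0: "partition_sum N a 0 ij = (if ij = (0, 0) then 1 else 0)"
proof -
  have "Pstar N 0 ij = (if ij = (0, 0) then {{#}} else {})"
    by (auto simp: Pstar_def zero_prod_def)
  then show ?thesis by (simp add: partition_sum_def mset_term_def)
qed

text \<open>Every element of \<open>Kstar N\<close> contributes at least 1 to the sum of the two
  coordinates.\<close>

lemma partition_sum_eq_0:
  assumes "i + j < l"
  shows "partition_sum N a l (i, j) = 0"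
proof -
  have size_le: "size S \<le> fst (sum_mset S) + snd (sum_mset S)" if "set_mset S \<subseteq> Kstar N" for S
    using that by (induction S) (auto simp: Kstar_def)
  have "S \<notin> Pstar N l (i, j)" for S
    using size_le[of S] assms by (auto simp: Pstar_def)
  then have "Pstar N l (i, j) = {}" by blast
  then show ?thesis by (simp add: partition_sum_def)
qed

section \<open>Bivariate formal power series\<close>

text \<open>The outer variable carries the column index \<open>j\<close>, the inner one the row
  index \<open>i\<close>.\<close>

definition bivariate_fps :: "(nat \<Rightarrow> nat \<Rightarrow> real) \<Rightarrow> real fps fps" where
  "bivariate_fps a = Abs_fps (\<lambda>j. Abs_fps (\<lambda>i. a i j))"

definition bicoeff :: "real fps fps \<Rightarrow> nat \<Rightarrow> nat \<Rightarrow> real" where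
  "bicoeff F i j = fps_nth (fps_nth F j) i"

lemma bicoeff_bivariate_fps [simp]: "bicoeff (bivariate_fps a) i j = a i j"
  by (simp add: bicoeff_def bivariate_fps_def)

lemma bicoeff_mult: "bicoeff (F * G) = conv_kernel (bicoeff F) (bicoeff G)"
proof (intro ext)
  fix i j
  show "bicoeff (F * G) i j = conv_kernel (bicoeff F) (bicoeff G) i j"
    unfolding bicoeff_def conv_kernel_def fps_mult_nth fps_sum_nth atLeast0AtMost
    by (rule sum.swap)
qed

lemma bicoeff_1: "bicoeff 1 i j = (if i = 0 \<and> j = 0 then 1 else 0)"
  by (simp add: bicoeff_def)

lemma bicoeff_sum: "bicoeff (sum F S) i j = (\<Sum>x\<in>S. bicoeff (F x) i j)"
  by (simp add: bicoeff_def fps_sum_nth)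

definition const2 :: "real \<Rightarrow> real fps fps" where
  "const2 x = fps_const (fps_const x)"

lemma bicoeff_const2_mult: "bicoeff (const2 x * F) i j = x * bicoeff F i j"
  by (simp add: bicoeff_def const2_def)

lemma const2_mult: "const2 (x * y) = const2 x * const2 y"
  by (simp add: const2_def)

lemma const2_power: "const2 x ^ n = const2 (x ^ n)"
  by (simp add: const2_def fps_const_power)

lemma const2_of_nat: "of_nat n = const2 (real n)"
  by (simp add: const2_def fps_of_nat)

text \<open>Multiplication by a series without constant term obeys the recursion
  \<open>partition_sum_Suc\<close>; \<open>fact l\<close> counts the orderings that the multisets
  forget.\<close>

lemma bicoeff_power_partition_sum:
  assumes "i < N" "j < N"
  shows "bicoeff (bivariate_fps (\<lambda>i j. if (i, j) = (0, 0) then 0 else a (i, j)) ^ l) i j =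
    fact l * partition_sum N a l (i, j)"
  using assms
proof (induction l arbitrary: i j)
  case 0
  then show ?case by (simp add: bicoeff_1 partition_sum_0)
next
  case (Suc l)
  define b where "b i j = (if (i, j) = (0, 0) then 0 else a (i, j))" for i j
  have b: "(\<lambda>i j. if (i, j) = (0, 0) then 0 else a (i, j)) = b"
    by (intro ext) (simp only: b_def)
  have "bicoeff (bivariate_fps b ^ Suc l) i j =
      (\<Sum>(p, q) \<in> {..i} \<times> {..j}. b p q * bicoeff (bivariate_fps b ^ l) (i - p) (j - q))"
    by (simp add: bicoeff_mult conv_kernel_def sum.cartesian_product)
  also have "\<dots> = (\<Sum>(p, q) \<in> {..i} \<times> {..j}.
      b p q * (fact l * partition_sum N a l (i - p, j - q)))"
    using Suc.prems by (intro sum.cong refl) (auto simp: Suc.IH[unfolded b])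
  also have "\<dots> = (\<Sum>(p, q) \<in> Kstar N \<inter> {..i} \<times> {..j}.
      a (p, q) * (fact l * partition_sum N a l (i - p, j - q)))"
    \<comment> \<open>The pair \<open>(0, 0)\<close> drops out because \<open>b 0 0 = 0\<close>; all
      other pairs lie in \<open>Kstar N\<close> since \<open>i\<close> and \<open>j\<close> are
      below \<open>N\<close>.\<close>
    using Suc.prems by (intro sum.mono_neutral_cong_right) (auto simp: Kstar_def b_def split: if_splits)
  also have "\<dots> = fact l * (\<Sum>(p, q) \<in> Kstar N \<inter> {..i} \<times> {..j}.
      a (p, q) * partition_sum N a l (i - p, j - q))"
    by (simp add: sum_distrib_left case_prod_beta mult_ac)
  also have "\<dots> = fact (Suc l) * partition_sum N a (Suc l) (i, j)"
    unfolding partition_sum_Suc[symmetric] by (simp add: mult_ac)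
  finally show ?case unfolding b .
qed

text \<open>The binomial theorem with the constant term split off. The range of \<open>l\<close>
  does not depend on \<open>k\<close>, so a series over \<open>k\<close> can later be taken inside
  this finite sum.\<close>

lemma bicoeff_power_expand:
  assumes "i < N" "j < N"
  shows "bicoeff (bivariate_fps (\<lambda>i j. a (i, j)) ^ k) i j =
    (\<Sum>l\<le>i + j. real (k choose l) * a (0, 0) ^ (k - l) * (fact l * partition_sum N a l (i, j)))"
proof -
  let ?B = "bivariate_fps (\<lambda>i j. if (i, j) = (0, 0) then 0 else a (i, j))"
  define t where "t l = real (k choose l) * a (0, 0) ^ (k - l) * (fact l * partition_sum N a l (i, j))"
    for l
  have "bivariate_fps (\<lambda>i j. a (i, j)) = ?B + const2 (a (0, 0))"
    by (simp add: bivariate_fps_def const2_def fps_eq_iff)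
  then have "bicoeff (bivariate_fps (\<lambda>i j. a (i, j)) ^ k) i j =
      bicoeff (\<Sum>l\<le>k. of_nat (k choose l) * ?B ^ l * const2 (a (0, 0)) ^ (k - l)) i j"
    by (simp only: binomial_ring)
  also have "\<dots> = (\<Sum>l\<le>k. bicoeff (const2 (real (k choose l) * a (0, 0) ^ (k - l)) * ?B ^ l) i j)"
    by (simp only: const2_power const2_of_nat bicoeff_sum const2_mult mult_ac)
  also have "\<dots> = (\<Sum>l\<le>k. t l)"
    by (simp only: bicoeff_const2_mult bicoeff_power_partition_sum[OF assms] t_def)
  \<comment> \<open>Terms with \<open>l > k\<close> vanish through the binomial coefficient, those
    with \<open>l > i + j\<close> through \<open>partition_sum_eq_0\<close>.\<close>
  also have "\<dots> = (\<Sum>l\<le>max k (i + j). t l)"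
    by (intro sum.mono_neutral_left) (auto simp: t_def)
  also have "\<dots> = (\<Sum>l\<le>i + j. t l)"
    by (intro sum.mono_neutral_right) (auto simp: t_def partition_sum_eq_0)
  finally show ?thesis by (simp add: t_def)
qed

text \<open>Powers are iterated convolutions, starting from the series 1, whose only nonzero
  coefficient sits at \<open>(0, 0)\<close>.\<close>

lemma psd_on_bicoeff_power:
  assumes "psd_on {..<N} a"
  shows "psd_on {..<N} (bicoeff (bivariate_fps a ^ k))"
proof (induction k)
  case 0
  have "(\<Sum>i<N. \<Sum>j<N. z i * z j * bicoeff 1 i j) = (\<Sum>i<N. if i = 0 then z 0 * z 0 else 0)"
    for z :: "nat \<Rightarrow> real"
    by (intro sum.cong refl)
      (auto simp: bicoeff_1 if_distrib[of "\<lambda>x. _ * x"] sum.delta cong: if_cong)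
  then show ?case by (simp add: psd_on_def bicoeff_1 sum.delta)
next
  case (Suc k)
  have "bicoeff (bivariate_fps a) = a" by (intro ext) simp
  then show ?case
    using psd_on_conv_kernel[OF assms Suc.IH] by (simp add: bicoeff_mult)
qed

section \<open>Derivatives of the power series and the series for \<open>diamond f A\<close>\<close>

text \<open>Termwise differentiation: \<open>(k choose l) * fact l\<close> is the falling factorial
  of \<open>k\<close>, written so as to match the binomial expansion.\<close>

lemma sums_higher_deriv_powser:
  fixes f :: "real \<Rightarrow> real" and c :: "nat \<Rightarrow> real"
  assumes f: "\<And>x. ereal \<bar>x\<bar> < conv_radius c \<Longrightarrow> f x = (\<Sum>k. c k * x ^ k)"
    and x: "ereal \<bar>x\<bar> < conv_radius c"
  shows "(\<lambda>k. c k * (real (k choose l) * x ^ (k - l) * fact l)) sums (deriv ^^ l) f x"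
proof -
  define F where "F = Abs_fps c"
  define D where "D l = (fps_deriv ^^ l) F" for l
  have radius: "conv_radius c \<le> fps_conv_radius (D l)" for l
  proof (induction l)
    case 0
    then show ?case by (simp add: D_def F_def fps_conv_radius_def)
  next
    case (Suc l)
    then show ?case using fps_conv_radius_deriv[of "D l"] by (simp add: D_def)
  qed
  define U where "U = {y::real. ereal \<bar>y\<bar> < conv_radius c}"
  have "open U"
    using open_eball[of "0::real" "conv_radius c"] by (simp add: U_def eball_def)
  \<comment> \<open>The identity is kept on all of the open set \<open>U\<close>, since the next
    derivative depends on a neighbourhood.\<close>
  have deriv: "\<forall>y\<in>U. (deriv ^^ l) f y = eval_fps (D l) y" for l
  proof (induction l)
    case 0
    then show ?case by (simp add: D_def F_def U_def f eval_fps_def)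
  next
    case (Suc l)
    show ?case
    proof
      fix y assume y: "y \<in> U"
      have "eventually (\<lambda>z. (deriv ^^ l) f z = eval_fps (D l) z) (nhds y)"
        unfolding eventually_nhds using Suc \<open>open U\<close> y by blast
      then have "deriv ((deriv ^^ l) f) y = deriv (eval_fps (D l)) y"
        by (rule deriv_cong_ev) simp
      also have "\<dots> = eval_fps (fps_deriv (D l)) y"
        using y radius[of l] by (intro eval_fps_deriv[symmetric]) (simp add: U_def)
      finally show "(deriv ^^ Suc l) f y = eval_fps (D (Suc l)) y" by (simp add: D_def)
    qed
  qed
  have coeff: "fps_nth (D l) n = c (n + l) * (real (n + l choose l) * fact l)" for n
  proof (induction l arbitrary: n)
    case 0
    then show ?case by (simp add: D_def F_def)
  next
    case (Suc l)
    have choose: "real (n + l choose l) * fact l = fact (n + l) / fact n" for n l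
      using binomial_fact[of l "n + l", where 'a = real] by simp
    have "real (Suc n) * (real (Suc n + l choose l) * fact l) =
        real (n + Suc l choose Suc l) * fact (Suc l)"
      unfolding choose by (simp del: of_nat_Suc)
    then show ?case using Suc.IH[of "Suc n"] by (simp add: D_def mult_ac)
  qed
  have "(\<lambda>n. fps_nth (D l) n * x ^ n) sums eval_fps (D l) x"
    using x radius[of l] by (intro sums_eval_fps) simp
  then have "(\<lambda>n. c (n + l) * (real (n + l choose l) * x ^ (n + l - l) * fact l)) sums (deriv ^^ l) f x"
    using deriv x by (simp add: coeff U_def mult_ac)
  then show ?thesis
    \<comment> \<open>The terms with \<open>k < l\<close> vanish because \<open>k choose l\<close>
      does, so the index may be shifted by \<open>l\<close>.\<close>
    by (subst (asm) sums_zero_iff_shift) auto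
qed

text \<open>Expanding each derivative at \<open>A $$ (0, 0)\<close> turns \<open>diamond\<close>
  into a series over \<open>k\<close> whose inner sums are the binomial expansions. Entries outside
  the matrix do not matter, as a coefficient of a power at \<open>(i, j)\<close> involves only
  indices up to \<open>(i, j)\<close>.\<close>

lemma diamond_sums:
  assumes A: "A \<in> carrier_mat N N" and ij: "i < N" "j < N"
    and f: "\<And>x. ereal \<bar>x\<bar> < conv_radius c \<Longrightarrow> f x = (\<Sum>k. c k * x ^ k)"
    and A00: "ereal \<bar>A $$ (0, 0)\<bar> < conv_radius c"
  shows "(\<lambda>k. c k * bicoeff (bivariate_fps (\<lambda>i j. A $$ (i, j)) ^ k) i j) sums diamond f A $$ (i, j)"
proof -
  let ?E = "\<lambda>l. partition_sum N (\<lambda>x. A $$ x) l (i, j)"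
  define d where "d l = (deriv ^^ l) f (A $$ (0, 0))" for l
  have "(\<lambda>k. \<Sum>l\<le>i + j. c k * (real (k choose l) * (A $$ (0, 0)) ^ (k - l) * fact l) * ?E l)
      sums (\<Sum>l\<le>i + j. d l * ?E l)"
    unfolding d_def by (intro sums_sum sums_mult2 sums_higher_deriv_powser f A00)
  moreover have "(\<Sum>l\<le>i + j. c k * (real (k choose l) * (A $$ (0, 0)) ^ (k - l) * fact l) * ?E l) =
      c k * bicoeff (bivariate_fps (\<lambda>i j. A $$ (i, j)) ^ k) i j" for k
    unfolding bicoeff_power_expand[OF ij, of "\<lambda>x. A $$ x"] sum_distrib_left
    by (simp add: mult_ac)
  \<comment> \<open>The term \<open>l = 0\<close> accounts for the case distinction in
    \<open>diamond\<close>: it is \<open>f (A $$ (0, 0))\<close> at \<open>(0, 0)\<close> and 0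
    elsewhere.\<close>
  moreover have "(\<Sum>l\<le>i + j. d l * ?E l) = diamond f A $$ (i, j)"
  proof (cases "(i, j) = (0, 0)")
    case True
    then show ?thesis using A ij by (simp add: diamond_def d_def partition_sum_0)
  next
    case False
    have "(\<Sum>l\<le>i + j. d l * ?E l) = (\<Sum>l=1..i + j. d l * ?E l)"
      using False by (intro sum.mono_neutral_right) (auto simp: partition_sum_0 not_le)
    then show ?thesis
      using A ij False by (auto simp: diamond_def d_def partition_sum_def mset_term_def)
  qed
  ultimately show ?thesis by simp
qed

theorem theorem1:
  fixes f :: "real \<Rightarrow> real" and c :: "nat \<Rightarrow> real" and R :: ereal and I :: "real set"
    and N :: nat and A :: "real mat"
  assumes "\<And>k. 0 \<le> c k"
    and "conv_radius c = R" and "0 < R"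
    and "I = {x. ereal \<bar>x\<bar> < R}"
    and "\<And>x. x \<in> I \<Longrightarrow> f x = (\<Sum>k. c k * x ^ k)"
    and "1 \<le> N"
    and "A \<in> carrier_mat N N"
    and "\<And>i j. i < N \<Longrightarrow> j < N \<Longrightarrow> A $$ (i, j) \<in> I"
    and "psd_mat (map_mat complex_of_real A)"
  shows "psd_mat (map_mat complex_of_real (diamond f A))"
proof -
  have D: "diamond f A \<in> carrier_mat N N"
    using assms(7) by (simp add: diamond_def)
  have "psd_on {..<N} (\<lambda>i j. A $$ (i, j))"
    using assms(9) psd_mat_of_real_iff[OF assms(7)] by simp
  then have "psd_on {..<N} (\<lambda>i j. diamond f A $$ (i, j))"
  proof (rule psd_on_sums[OF psd_on_bicoeff_power assms(1)])
    fix i j assume "i \<in> {..<N}" "j \<in> {..<N}"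
    then show "(\<lambda>k. c k * bicoeff (bivariate_fps (\<lambda>i j. A $$ (i, j)) ^ k) i j)
        sums diamond f A $$ (i, j)"
      \<comment> \<open>As \<open>1 \<le> N\<close>, the pair \<open>(0, 0)\<close> is an index of
        \<open>A\<close>, so the expansion point lies in \<open>I\<close>.\<close>
      using assms(2,4,5,6) assms(8)[of 0 0] by (intro diamond_sums[OF assms(7)]) auto
  qed
  then show ?thesis using psd_mat_of_real_iff[OF D] by simp
qed

end
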